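(* Let $G$ be a finite simple undirected graph and let $H$ be a graph obtained from $G$ by inserting one edge between two non-adjacent distinct vertices or by deleting one edge. Then \[\operatorname{nlcw}(G)-2\le\operatorname{nlcw}(H)\le\operatorname{nlcw}(G)+2\quad\text{and}\quad \operatorname{cw}(G)-2\le\operatorname{cw}(H)\le\operatorname{cw}(G)+2.\]
   Context: Clique-width: for a positive integer $k$, $\mathrm{CW}_k$ is the smallest class of graphs whose vertices carry labels from $\{1,\dots,k\}$ that contains every single-vertex graph with any label and is closed under: disjoint union; relabeling $\rho_{a\to b}$ for $a\neq b$; and $\eta_{a,b}$ for $a\neq b$ (add all edges between vertices labeled $a$ and vertices labeled $b$). $\operatorname{cw}(G)$ is the least $k$ such that some labeling of $G$ lies in $\mathrm{CW}_k$. NLC-width: $\mathrm{NLC}_k$ is the smallest class of labeled graphs (labels in $\{1,\dots,k\}$) containing every single-vertex graph with any label and closed under: $G\times_S J$ for $S\subseteq\{1,\dots,k\}^2$ (disjoint union of vertex-disjoint $G$ and $J$ plus all edges $\{u,v\}$, $u\in V_G$, $v\in V_J$, $(\mathrm{lab}(u),\mathrm{lab}(v))\in S$); and $\circ_R$ for $R:\{1,\dots,k\}\to\{1,\dots,k\}$. $\operatorname{nlcw}(G)$ is the least $k$ such that some labeling of $G$ lies in $\mathrm{NLC}_k$. *)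

theory Defs
  imports Main
begin

text \<open>
  A graph is given by its vertex set and its set of two-element edges.
\<close>

definition finite_simple_graph :: "'a set \<Rightarrow> 'a set set \<Rightarrow> bool" where
  "finite_simple_graph V E \<longleftrightarrow>
     finite V \<and> E \<subseteq> {{u, v} | u v. u \<in> V \<and> v \<in> V \<and> u \<noteq> v}"

text \<open>
  The labelling of a labelled graph is a total function of which only the values on the vertex
  set are meaningful; the rules below leave its values outside the vertex set arbitrary.
\<close>

inductive CW :: "nat \<Rightarrow> 'a set \<Rightarrow> 'a set set \<Rightarrow> ('a \<Rightarrow> nat) \<Rightarrow> bool" for k :: nat where
  single: "lab v \<in> {1..k} \<Longrightarrow> CW k {v} {} lab"
| disjoint_union:
    "\<lbrakk>CW k V\<^sub>1 E\<^sub>1 lab\<^sub>1; CW k V\<^sub>2 E\<^sub>2 lab\<^sub>2; V\<^sub>1 \<inter> V\<^sub>2 = {}\<rbrakk>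
     \<Longrightarrow> CW k (V\<^sub>1 \<union> V\<^sub>2) (E\<^sub>1 \<union> E\<^sub>2) (\<lambda>x. if x \<in> V\<^sub>1 then lab\<^sub>1 x else lab\<^sub>2 x)"
| relabel:
    "\<lbrakk>CW k V E lab; a \<in> {1..k}; b \<in> {1..k}; a \<noteq> b\<rbrakk>
     \<Longrightarrow> CW k V E (\<lambda>x. if lab x = a then b else lab x)"
| join:
    "\<lbrakk>CW k V E lab; a \<in> {1..k}; b \<in> {1..k}; a \<noteq> b\<rbrakk>
     \<Longrightarrow> CW k V (E \<union> {{u, v} | u v. u \<in> V \<and> v \<in> V \<and> lab u = a \<and> lab v = b}) lab"

inductive NLC :: "nat \<Rightarrow> 'a set \<Rightarrow> 'a set set \<Rightarrow> ('a \<Rightarrow> nat) \<Rightarrow> bool" for k :: nat where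
  single: "lab v \<in> {1..k} \<Longrightarrow> NLC k {v} {} lab"
| product:
    "\<lbrakk>NLC k V\<^sub>1 E\<^sub>1 lab\<^sub>1; NLC k V\<^sub>2 E\<^sub>2 lab\<^sub>2; V\<^sub>1 \<inter> V\<^sub>2 = {}; S \<subseteq> {1..k} \<times> {1..k}\<rbrakk>
     \<Longrightarrow> NLC k (V\<^sub>1 \<union> V\<^sub>2)
           (E\<^sub>1 \<union> E\<^sub>2 \<union> {{u, v} | u v. u \<in> V\<^sub>1 \<and> v \<in> V\<^sub>2 \<and> (lab\<^sub>1 u, lab\<^sub>2 v) \<in> S})
           (\<lambda>x. if x \<in> V\<^sub>1 then lab\<^sub>1 x else lab\<^sub>2 x)"
| relabel:
    "\<lbrakk>NLC k V E lab; R ` {1..k} \<subseteq> {1..k}\<rbrakk> \<Longrightarrow> NLC k V E (R \<circ> lab)"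

text \<open>
  For a finite simple graph the minima below exist as soon as the graph has a vertex;
  for the empty graph no labelling lies in any of the classes.
\<close>

definition cw :: "'a set \<Rightarrow> 'a set set \<Rightarrow> nat" where
  "cw V E = (LEAST k. k > 0 \<and> (\<exists>lab. CW k V E lab))"

definition nlcw :: "'a set \<Rightarrow> 'a set set \<Rightarrow> nat" where
  "nlcw V E = (LEAST k. k > 0 \<and> (\<exists>lab. NLC k V E lab))"

end

theory Submission
  imports Defs
begin

text \<open>
  Let \<open>u\<close> and \<open>v\<close> be the ends of the edge. Rerun a construction of \<open>G\<close> in which \<open>u\<close> and \<open>v\<close>
  carry two private labels throughout. Every step that inserts edges can be imitated, because it may
  treat a private label like the label that its only bearer has in the original construction; the
  one pair that can now be decided freely is the pair of the two private labels, that is, \<open>{u, v}\<close>.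
  So two additional labels suffice, and the relation between \<open>G\<close> and \<open>H\<close> is symmetric.
\<close>

definition private_lab :: "nat \<Rightarrow> 'a \<Rightarrow> 'a \<Rightarrow> ('a \<Rightarrow> nat) \<Rightarrow> 'a \<Rightarrow> nat" where
  "private_lab k u v lab = lab(u := k + 1, v := k + 2)"

text \<open>Translates labels of the imitation back. What a private label stands for changes during
  the construction, hence the dependence on the current \<open>lab\<close>.\<close>

definition public_lab :: "nat \<Rightarrow> 'a \<Rightarrow> 'a \<Rightarrow> ('a \<Rightarrow> nat) \<Rightarrow> nat \<Rightarrow> nat" where
  "public_lab k u v lab = id(k + 1 := lab u, k + 2 := lab v)"

lemma public_private_lab:
  "u \<noteq> v \<Longrightarrow> lab x \<in> {1..k} \<Longrightarrow> public_lab k u v lab (private_lab k u v lab x) = lab x"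
  by (auto simp: public_lab_def private_lab_def)

lemma private_lab_range:
  "lab x \<in> {1..k} \<Longrightarrow> private_lab k u v lab x \<in> {1..k + 2}"
  by (auto simp: private_lab_def)

text \<open>Original labels are at most \<open>k\<close>, so a private label identifies its bearer.
  Two labellings occur because a product compares vertices of different parts.\<close>

lemma private_lab_pair_iff:
  assumes "u \<noteq> v" "lab\<^sub>1 x \<in> {1..k}" "lab\<^sub>2 y \<in> {1..k}"
  shows "{private_lab k u v lab\<^sub>1 x, private_lab k u v lab\<^sub>2 y} = {k + 1, k + 2} \<longleftrightarrow> {x, y} = {u, v}"
  using assms by (auto simp: private_lab_def doubleton_eq_iff)

lemma CW_lab_range: "CW k V E lab \<Longrightarrow> x \<in> V \<Longrightarrow> lab x \<in> {1..k}"
  by (induction arbitrary: x rule: CW.induct) (auto split: if_splits)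

lemma NLC_lab_range: "NLC k V E lab \<Longrightarrow> x \<in> V \<Longrightarrow> lab x \<in> {1..k}"
  by (induction arbitrary: x rule: NLC.induct) (auto simp: image_subset_iff split: if_splits)

text \<open>A join changes neither vertices nor labels, so the pairs in \<open>S\<close> can be
  joined one after another. This is needed because one original join splits into several once
  \<open>u\<close> and \<open>v\<close> have left their label classes.\<close>

lemma CW_joins:
  assumes "CW k V E lab" "finite S" "S \<subseteq> {1..k} \<times> {1..k}" "\<forall>(a, b)\<in>S. a \<noteq> b"
  shows "CW k V (E \<union> {{x, y} | x y. x \<in> V \<and> y \<in> V \<and> (lab x, lab y) \<in> S}) lab"
  using assms(2-)
proof (induction S)
  case empty
  then show ?case using assms(1) by simp
next
  case (insert p S)
  obtain a b where p: "p = (a, b)" by (cases p)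
  let ?E = "E \<union> {{x, y} | x y. x \<in> V \<and> y \<in> V \<and> (lab x, lab y) \<in> S}"
  have "CW k V (?E \<union> {{x, y} | x y. x \<in> V \<and> y \<in> V \<and> lab x = a \<and> lab y = b}) lab"
    using insert p by (intro CW.join) auto
  moreover have "?E \<union> {{x, y} | x y. x \<in> V \<and> y \<in> V \<and> lab x = a \<and> lab y = b} =
      E \<union> {{x, y} | x y. x \<in> V \<and> y \<in> V \<and> (lab x, lab y) \<in> insert p S}"
    using p by blast
  ultimately show ?case by simp
qed

lemma image_pairs_avoiding:
  "{f x y | x y. A x y \<and> f x y \<noteq> d \<and> Q x y} = {f x y | x y. A x y \<and> Q x y} - {d}"
  by blast

text \<open>Here \<open>d\<close> will be the edge between \<open>u\<close> and \<open>v\<close>: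
  overriding the test at \<open>d\<close> affects membership of \<open>d\<close> alone, and
  \<open>d\<close> can be present only if some admissible pair yields it.\<close>

lemma image_pairs_deciding:
  "{f x y | x y. A x y \<and> (if f x y = d then P else Q x y)} =
    ({f x y | x y. A x y \<and> Q x y} - {d}) \<union> {e. P \<and> e = d \<and> (\<exists>x y. A x y \<and> f x y = d)}"
  unfolding if_bool_eq_conj by blast

text \<open>The edge between \<open>u\<close> and \<open>v\<close> is always left out: as both keep
  private labels to the end, a final join can still add it.\<close>

lemma CW_private:
  assumes "CW k V E lab" "u \<noteq> v"
  shows "\<exists>lab'. CW (k + 2) V (E - {{u, v}}) lab' \<and> (\<forall>x\<in>V. lab' x = private_lab k u v lab x)"
  using assms(1)
proof (induction rule: CW.induct)
  case (single lab w)
  then have "CW (k + 2) {w} {} (private_lab k u v lab)"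
    by (intro CW.single private_lab_range)
  then show ?case by auto
next
  case (disjoint_union V\<^sub>1 E\<^sub>1 lab\<^sub>1 V\<^sub>2 E\<^sub>2 lab\<^sub>2)
  then obtain l\<^sub>1 l\<^sub>2 where
    l: "CW (k + 2) V\<^sub>1 (E\<^sub>1 - {{u, v}}) l\<^sub>1" "\<forall>x\<in>V\<^sub>1. l\<^sub>1 x = private_lab k u v lab\<^sub>1 x"
       "CW (k + 2) V\<^sub>2 (E\<^sub>2 - {{u, v}}) l\<^sub>2" "\<forall>x\<in>V\<^sub>2. l\<^sub>2 x = private_lab k u v lab\<^sub>2 x"
    by blast
  have "CW (k + 2) (V\<^sub>1 \<union> V\<^sub>2) ((E\<^sub>1 \<union> E\<^sub>2) - {{u, v}}) (\<lambda>x. if x \<in> V\<^sub>1 then l\<^sub>1 x else l\<^sub>2 x)"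
    using CW.disjoint_union[OF l(1,3) disjoint_union.hyps(3)] by (simp add: Un_Diff)
  moreover have "\<forall>x\<in>V\<^sub>1 \<union> V\<^sub>2. (if x \<in> V\<^sub>1 then l\<^sub>1 x else l\<^sub>2 x) =
      private_lab k u v (\<lambda>x. if x \<in> V\<^sub>1 then lab\<^sub>1 x else lab\<^sub>2 x) x"
    using l(2,4) by (auto simp: private_lab_def)
  ultimately show ?case by blast
next
  case (relabel V E lab a b)
  then obtain l where l: "CW (k + 2) V (E - {{u, v}}) l" "\<forall>x\<in>V. l x = private_lab k u v lab x"
    by blast
  \<comment> \<open>Since \<open>a\<close> is at most \<open>k\<close>, the same relabelling leaves
    the private labels alone.\<close>
  have "CW (k + 2) V (E - {{u, v}}) (\<lambda>x. if l x = a then b else l x)"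
    using relabel.hyps by (intro CW.relabel l) auto
  moreover have "\<forall>x\<in>V. (if l x = a then b else l x) =
      private_lab k u v (\<lambda>x. if lab x = a then b else lab x) x"
    using l(2) relabel.hyps by (auto simp: private_lab_def)
  ultimately show ?case by blast
next
  case (join V E lab a b)
  then obtain l where l: "CW (k + 2) V (E - {{u, v}}) l" "\<forall>x\<in>V. l x = private_lab k u v lab x"
    by blast
  let ?g = "public_lab k u v lab"
  \<comment> \<open>All label pairs that stand for \<open>(a, b)\<close>, except the two private
    labels together.\<close>
  define S where "S = {(i, j) \<in> {1..k + 2} \<times> {1..k + 2}.
    {i, j} \<noteq> {k + 1, k + 2} \<and> ?g i = a \<and> ?g j = b}"
  have S_iff: "(l x, l y) \<in> S \<longleftrightarrow> {x, y} \<noteq> {u, v} \<and> lab x = a \<and> lab y = b"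
    if "x \<in> V" "y \<in> V" for x y
  proof -
    have r: "lab x \<in> {1..k}" "lab y \<in> {1..k}"
      using CW_lab_range[OF join.hyps(1)] that by auto
    have eq: "l x = private_lab k u v lab x" "l y = private_lab k u v lab y"
      using l(2) that by auto
    have "{l x, l y} = {k + 1, k + 2} \<longleftrightarrow> {x, y} = {u, v}"
      unfolding eq by (intro private_lab_pair_iff \<open>u \<noteq> v\<close> r)
    moreover have "l x \<in> {1..k + 2}" "l y \<in> {1..k + 2}"
      unfolding eq by (intro private_lab_range r)+
    moreover have "public_lab k u v lab (l x) = lab x" "public_lab k u v lab (l y) = lab y"
      unfolding eq by (intro public_private_lab \<open>u \<noteq> v\<close> r)+
    ultimately show ?thesis by (simp add: S_def)
  qed
  have fin: "finite S"
    by (rule finite_subset[of _ "{1..k + 2} \<times> {1..k + 2}"]) (auto simp: S_def)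
  have "CW (k + 2) V ((E - {{u, v}}) \<union> {{x, y} | x y. x \<in> V \<and> y \<in> V \<and> (l x, l y) \<in> S}) l"
    \<comment> \<open>The components of a pair in \<open>S\<close> differ because \<open>?g\<close>
      maps them to \<open>a\<close> and \<open>b\<close>.\<close>
    using \<open>a \<noteq> b\<close> by (intro CW_joins l fin) (auto simp: S_def)
  moreover have "{{x, y} | x y. x \<in> V \<and> y \<in> V \<and> (l x, l y) \<in> S} =
      {{x, y} | x y. (x \<in> V \<and> y \<in> V) \<and> {x, y} \<noteq> {u, v} \<and> lab x = a \<and> lab y = b}"
    by (simp add: S_iff cong: conj_cong)
  moreover have "\<dots> = {{x, y} | x y. (x \<in> V \<and> y \<in> V) \<and> lab x = a \<and> lab y = b} - {{u, v}}"
    by (rule image_pairs_avoiding)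
  ultimately show ?case using l(2) by (auto simp: Un_Diff)
qed

text \<open>A product adds edges only between its two parts, so the edge between \<open>u\<close>
  and \<open>v\<close> must be decided where they first meet; \<open>P\<close> is that decision,
  fixed in advance. The membership conditions keep the edge out before that moment.\<close>

lemma NLC_private:
  assumes "NLC k V E lab" "u \<noteq> v"
  shows "\<exists>lab'. NLC (k + 2) V ((E - {{u, v}}) \<union> {e. P \<and> e = {u, v} \<and> u \<in> V \<and> v \<in> V}) lab' \<and>
    (\<forall>x\<in>V. lab' x = private_lab k u v lab x)"
    (is "\<exists>lab'. NLC _ _ (?D V E) _ \<and> _")
  using assms(1)
proof (induction rule: NLC.induct)
  case (single lab w)
  then have "NLC (k + 2) {w} {} (private_lab k u v lab)"
    by (intro NLC.single private_lab_range)
  moreover have "?D {w} {} = {}" using \<open>u \<noteq> v\<close> by auto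
  ultimately show ?case by auto
next
  case (product V\<^sub>1 E\<^sub>1 lab\<^sub>1 V\<^sub>2 E\<^sub>2 lab\<^sub>2 S)
  from product.IH obtain l\<^sub>1 l\<^sub>2 where
    l: "NLC (k + 2) V\<^sub>1 (?D V\<^sub>1 E\<^sub>1) l\<^sub>1" "\<forall>x\<in>V\<^sub>1. l\<^sub>1 x = private_lab k u v lab\<^sub>1 x"
       "NLC (k + 2) V\<^sub>2 (?D V\<^sub>2 E\<^sub>2) l\<^sub>2" "\<forall>x\<in>V\<^sub>2. l\<^sub>2 x = private_lab k u v lab\<^sub>2 x"
    by blast
  \<comment> \<open>Pulls \<open>S\<close> back along the public labels of each side and lets
    \<open>P\<close> overrule it on the private pair. That pair is tested as a set, since either of
    \<open>u\<close> and \<open>v\<close> may lie in the first part.\<close>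
  define S' where "S' = {(i, j) \<in> {1..k + 2} \<times> {1..k + 2}. if {i, j} = {k + 1, k + 2} then P
    else (public_lab k u v lab\<^sub>1 i, public_lab k u v lab\<^sub>2 j) \<in> S}"
  have S'_iff: "(l\<^sub>1 x, l\<^sub>2 y) \<in> S' \<longleftrightarrow> (if {x, y} = {u, v} then P else (lab\<^sub>1 x, lab\<^sub>2 y) \<in> S)"
    if "x \<in> V\<^sub>1" "y \<in> V\<^sub>2" for x y
  proof -
    have r: "lab\<^sub>1 x \<in> {1..k}" "lab\<^sub>2 y \<in> {1..k}"
      using that product.hyps(1,2)[THEN NLC_lab_range] by auto
    have eq: "l\<^sub>1 x = private_lab k u v lab\<^sub>1 x" "l\<^sub>2 y = private_lab k u v lab\<^sub>2 y"
      using l(2,4) that by auto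
    have "{l\<^sub>1 x, l\<^sub>2 y} = {k + 1, k + 2} \<longleftrightarrow> {x, y} = {u, v}"
      unfolding eq by (intro private_lab_pair_iff \<open>u \<noteq> v\<close> r)
    moreover have "l\<^sub>1 x \<in> {1..k + 2}" "l\<^sub>2 y \<in> {1..k + 2}"
      unfolding eq by (intro private_lab_range r)+
    moreover have "public_lab k u v lab\<^sub>1 (l\<^sub>1 x) = lab\<^sub>1 x" "public_lab k u v lab\<^sub>2 (l\<^sub>2 y) = lab\<^sub>2 y"
      unfolding eq by (intro public_private_lab \<open>u \<noteq> v\<close> r)+
    ultimately show ?thesis by (simp add: S'_def)
  qed
  let ?X = "{{x, y} | x y. x \<in> V\<^sub>1 \<and> y \<in> V\<^sub>2 \<and> (lab\<^sub>1 x, lab\<^sub>2 y) \<in> S}"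
  let ?X' = "{{x, y} | x y. x \<in> V\<^sub>1 \<and> y \<in> V\<^sub>2 \<and> (l\<^sub>1 x, l\<^sub>2 y) \<in> S'}"
  have constr: "NLC (k + 2) (V\<^sub>1 \<union> V\<^sub>2) (?D V\<^sub>1 E\<^sub>1 \<union> ?D V\<^sub>2 E\<^sub>2 \<union> ?X')
      (\<lambda>x. if x \<in> V\<^sub>1 then l\<^sub>1 x else l\<^sub>2 x)"
    using product.hyps(3) by (intro NLC.product l) (auto simp: S'_def)
  have edges: "?D V\<^sub>1 E\<^sub>1 \<union> ?D V\<^sub>2 E\<^sub>2 \<union> ?X' = ?D (V\<^sub>1 \<union> V\<^sub>2) (E\<^sub>1 \<union> E\<^sub>2 \<union> ?X)"
  proof -
    have "?X' = {{x, y} | x y. (x \<in> V\<^sub>1 \<and> y \<in> V\<^sub>2) \<and>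
        (if {x, y} = {u, v} then P else (lab\<^sub>1 x, lab\<^sub>2 y) \<in> S)}"
      by (simp add: S'_iff cong: conj_cong)
    also have "\<dots> = ({{x, y} | x y. (x \<in> V\<^sub>1 \<and> y \<in> V\<^sub>2) \<and> (lab\<^sub>1 x, lab\<^sub>2 y) \<in> S} - {{u, v}}) \<union>
        {e. P \<and> e = {u, v} \<and> (\<exists>x y. (x \<in> V\<^sub>1 \<and> y \<in> V\<^sub>2) \<and> {x, y} = {u, v})}"
      by (rule image_pairs_deciding)
    also have "(\<exists>x y. (x \<in> V\<^sub>1 \<and> y \<in> V\<^sub>2) \<and> {x, y} = {u, v}) \<longleftrightarrow>
        u \<in> V\<^sub>1 \<and> v \<in> V\<^sub>2 \<or> v \<in> V\<^sub>1 \<and> u \<in> V\<^sub>2"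
      by (auto simp: doubleton_eq_iff)
    finally have X': "?X' = (?X - {{u, v}}) \<union>
        {e. P \<and> e = {u, v} \<and> (u \<in> V\<^sub>1 \<and> v \<in> V\<^sub>2 \<or> v \<in> V\<^sub>1 \<and> u \<in> V\<^sub>2)}"
      by (simp only: conj_assoc)
    show ?thesis
      \<comment> \<open>What remains is propositional: \<open>u\<close> and \<open>v\<close> lie in
        the same part or in different ones.\<close>
      unfolding X' Un_Diff by (intro set_eqI) (simp only: Un_iff mem_Collect_eq, argo)
  qed
  have labels: "\<forall>x\<in>V\<^sub>1 \<union> V\<^sub>2. (if x \<in> V\<^sub>1 then l\<^sub>1 x else l\<^sub>2 x) =
      private_lab k u v (\<lambda>x. if x \<in> V\<^sub>1 then lab\<^sub>1 x else lab\<^sub>2 x) x"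
    using l(2,4) by (auto simp: private_lab_def)
  show ?case
    by (rule exI, rule conjI[OF constr[unfolded edges] labels])
next
  case (relabel V E lab R)
  from relabel.IH obtain l where
    l: "NLC (k + 2) V (?D V E) l" "\<forall>x\<in>V. l x = private_lab k u v lab x"
    by blast
  \<comment> \<open>\<open>R\<close> is constrained only on \<open>{1..k}\<close>, so it is made to
    fix the private labels explicitly.\<close>
  let ?R = "R(k + 1 := k + 1, k + 2 := k + 2)"
  have "?R i \<in> {1..k + 2}" if "i \<in> {1..k + 2}" for i
  proof (cases "i \<in> {1..k}")
    case True
    then have "R i \<in> {1..k}" using relabel.hyps(2) by blast
    then show ?thesis by auto
  qed (use that in auto)
  then have "NLC (k + 2) V (?D V E) (?R \<circ> l)"
    by (intro NLC.relabel l) blast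
  moreover have "\<forall>x\<in>V. (?R \<circ> l) x = private_lab k u v (R \<circ> lab) x"
    using l(2) NLC_lab_range[OF relabel.hyps(1)] by (fastforce simp: private_lab_def)
  ultimately show ?case by blast
qed

lemma CW_toggle_edge:
  assumes "CW k V E lab" "u \<noteq> v" "u \<in> V" "v \<in> V" "F - {{u, v}} = E - {{u, v}}"
  shows "\<exists>lab'. CW (k + 2) V F lab'"
proof -
  obtain l where l: "CW (k + 2) V (F - {{u, v}}) l" "\<forall>x\<in>V. l x = private_lab k u v lab x"
    using CW_private[OF assms(1,2)] assms(5) by auto
  show ?thesis
  proof (cases "{u, v} \<in> F")
    case True
    \<comment> \<open>The private labels have one bearer each, so joining them adds exactly the
      wanted edge.\<close>
    have uv: "x \<in> V \<Longrightarrow> l x = k + 1 \<longleftrightarrow> x = u" "x \<in> V \<Longrightarrow> l x = k + 2 \<longleftrightarrow> x = v" for x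
      using l(2) CW_lab_range[OF assms(1)] \<open>u \<noteq> v\<close> by (force simp: private_lab_def)+
    have "CW (k + 2) V ((F - {{u, v}}) \<union>
        {{x, y} | x y. x \<in> V \<and> y \<in> V \<and> l x = k + 1 \<and> l y = k + 2}) l"
      by (intro CW.join l) auto
    moreover have "{{x, y} | x y. x \<in> V \<and> y \<in> V \<and> l x = k + 1 \<and> l y = k + 2} = {{u, v}}"
      using uv assms(3,4) by blast
    ultimately show ?thesis using True by (auto simp: insert_absorb)
  qed (use l in auto)
qed

lemma NLC_toggle_edge:
  assumes "NLC k V E lab" "u \<noteq> v" "u \<in> V" "v \<in> V" "F - {{u, v}} = E - {{u, v}}"
  shows "\<exists>lab'. NLC (k + 2) V F lab'"
proof -
  \<comment> \<open>The decision \<open>P\<close> is instantiated with membership of the edge in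
    \<open>F\<close>.\<close>
  have "(E - {{u, v}}) \<union> {e. {u, v} \<in> F \<and> e = {u, v} \<and> u \<in> V \<and> v \<in> V} = F"
    unfolding assms(5)[symmetric] using assms(3,4) by auto
  then show ?thesis using NLC_private[OF assms(1,2), of "{u, v} \<in> F"] by auto
qed

text \<open>
  If one predicate is nowhere true, then so is the other and the two junk values of
  \<open>LEAST\<close> agree. This makes it unnecessary to know that every nonempty finite graph has a
  construction.
\<close>

lemma Least_shift_bound:
  fixes P Q :: "nat \<Rightarrow> bool"
  assumes PQ: "\<And>k. P k \<Longrightarrow> Q (k + c)" and QP: "\<And>k. Q k \<Longrightarrow> P (k + c)"
  shows "int (Least P) - int c \<le> int (Least Q) \<and> int (Least Q) \<le> int (Least P) + int c"
proof (cases "\<exists>k. P k")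
  case True
  then have "P (Least P)" "Q (Least Q)"
    using PQ by (metis LeastI)+
  then have "Least Q \<le> Least P + c" "Least P \<le> Least Q + c"
    using PQ QP by (auto intro: Least_le)
  then show ?thesis by linarith
next
  case False
  then have "P = Q" using QP by blast
  then show ?thesis by simp
qed

theorem theorem8:
  fixes V :: "'a set" and E F :: "'a set set"
  assumes "finite_simple_graph V E"
    and "(\<exists>u\<in>V. \<exists>v\<in>V. u \<noteq> v \<and> {u, v} \<notin> E \<and> F = E \<union> {{u, v}}) \<or> (\<exists>e\<in>E. F = E - {e})"
  shows "(int (nlcw V E) - 2 \<le> int (nlcw V F) \<and> int (nlcw V F) \<le> int (nlcw V E) + 2) \<and>
         (int (cw V E) - 2 \<le> int (cw V F) \<and> int (cw V F) \<le> int (cw V E) + 2)"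
proof -
  \<comment> \<open>Insertion and deletion both give edge sets that agree apart from one pair, a
    symmetric relation; hence each toggle lemma applies in both directions.\<close>
  obtain u v where uv: "u \<noteq> v" "u \<in> V" "v \<in> V" and F: "F - {{u, v}} = E - {{u, v}}"
  proof -
    consider u v where "u \<in> V" "v \<in> V" "u \<noteq> v" "F = E \<union> {{u, v}}" | e where "e \<in> E" "F = E - {e}"
      using assms(2) by blast
    then show thesis
    proof cases
      case 1
      then show thesis by (intro that[of u v]) auto
    next
      case 2
      then obtain u v where "e = {u, v}" "u \<in> V" "v \<in> V" "u \<noteq> v"
        using assms(1) unfolding finite_simple_graph_def by blast
      with 2 show thesis by (intro that[of u v]) auto
    qed
  qed
  note toggles = CW_toggle_edge[OF _ uv F] CW_toggle_edge[OF _ uv F[symmetric]]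
    NLC_toggle_edge[OF _ uv F] NLC_toggle_edge[OF _ uv F[symmetric]]
  have "int (nlcw V E) - int 2 \<le> int (nlcw V F) \<and> int (nlcw V F) \<le> int (nlcw V E) + int 2"
    unfolding nlcw_def by (rule Least_shift_bound) (use toggles in auto)
  moreover have "int (cw V E) - int 2 \<le> int (cw V F) \<and> int (cw V F) \<le> int (cw V E) + int 2"
    unfolding cw_def by (rule Least_shift_bound) (use toggles in auto)
  ultimately show ?thesis by simp
qed

end
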